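(* Let $X$ be a Hausdorff topological space. Then $|X| \leq g(X)^{L(X) \cdot F(X)}$, where $g(X)$ is the depth of $X$, $L(X)$ is the Lindelöf degree of $X$, and $F(X)$ is the supremum of the cardinalities of the free sequences in $X$.
   Context: Let $X$ be a topological space; closures $\overline{A}$ are taken in $X$. - A subset $D \subset X$ is discrete if the subspace topology on $D$ is the discrete topology ($D$ is not required to be closed). The depth of $X$ is $g(X) = \sup\{|\overline{D}| : D \subset X \text{ is discrete}\}$. - The Lindelöf degree (Lindelöf number) $L(X)$ is the least infinite cardinal $\lambda$ such that every open cover of $X$ has a subcover of cardinality at most $\lambda$. - A well-ordered set $\{x_\alpha : \alpha < \kappa\} \subset X$ (indexed by an ordinal $\kappa$) is called a free sequence in $X$ if for every $\beta < \kappa$ we have $\overline{\{x_\alpha : \alpha < \beta\}} \cap \overline{\{x_\alpha : \beta \leq \alpha < \kappa\}} = \emptyset$. Then $F(X)$ denotes the supremum of the cardinalities of free sequences in $X$. Products and powers are those of cardinal arithmetic. *)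

theory Defs
  imports "HOL-Analysis.Analysis"
begin

unbundle cardinal_syntax

text \<open>
  Cardinals are relations satisfying \<^term>\<open>Card_order\<close>, determined up to \<open>=o\<close>.
  The choice below is restricted to cardinals carried by the type \<open>'b\<close>.  If some cardinal on \<open>'b\<close>
  has the property, then every cardinal not realised on \<open>'b\<close> is larger, so nothing is lost by the
  restriction; the lemmas \<open>card_Sup_least\<close>, \<open>Lindelof_degree_least\<close> and \<open>free_sequence_number_upper\<close>
  state this across arbitrary types.
\<close>

definition least_card :: "('b rel \<Rightarrow> bool) \<Rightarrow> 'b rel" where
  "least_card P = (SOME r. Card_order r \<and> P r \<and> (\<forall>s. Card_order s \<and> P s \<longrightarrow> r \<le>o s))"

definition card_Sup :: "'a set set \<Rightarrow> 'a rel" where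
  "card_Sup \<A> = least_card (\<lambda>r. \<forall>A\<in>\<A>. |A| \<le>o r)"

definition discrete_subset :: "'a topology \<Rightarrow> 'a set \<Rightarrow> bool" where
  "discrete_subset X D \<longleftrightarrow> D \<subseteq> topspace X \<and> subtopology X D = discrete_topology D"

definition depth :: "'a topology \<Rightarrow> 'a rel" where
  "depth X = card_Sup {X closure_of D | D. discrete_subset X D}"

definition covers_reduce_to :: "'a topology \<Rightarrow> 'b rel \<Rightarrow> bool" where
  "covers_reduce_to X r \<longleftrightarrow>
     (\<forall>\<U>. (\<forall>U\<in>\<U>. openin X U) \<and> \<Union>\<U> = topspace X \<longrightarrow>
          (\<exists>\<V>. \<V> \<subseteq> \<U> \<and> \<Union>\<V> = topspace X \<and> |\<V>| \<le>o r))"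

text \<open>The summand \<^typ>\<open>nat\<close> provides an infinite cardinal even when \<open>'a\<close> is finite.\<close>

definition Lindelof_degree :: "'a topology \<Rightarrow> ('a + nat) rel" where
  "Lindelof_degree X = least_card (\<lambda>r. cinfinite r \<and> covers_reduce_to X r)"

text \<open>The ordinal indexing the sequence is represented by an arbitrary well-order \<open>r\<close>.\<close>

definition free_sequence :: "'a topology \<Rightarrow> 'i rel \<Rightarrow> ('i \<Rightarrow> 'a) \<Rightarrow> bool" where
  "free_sequence X r x \<longleftrightarrow>
     Well_order r \<and> x ` Field r \<subseteq> topspace X \<and>
     (\<forall>\<beta>\<in>Field r. X closure_of (x ` underS r \<beta>) \<inter> X closure_of (x ` above r \<beta>) = {})"

text \<open>
  Free sequences are injective, so every ordinal indexing one is isomorphic to a well-order of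
  a set of points, and index orders on the type of points suffice.
\<close>

definition free_sequence_number :: "'a topology \<Rightarrow> 'a rel" where
  "free_sequence_number X = card_Sup {x ` Field r | (r :: 'a rel) x. free_sequence X r x}"

lemma least_card:
  fixes P :: "'b rel \<Rightarrow> bool"
  assumes "Card_order r0" "P r0"
  shows "Card_order (least_card P)" and "P (least_card P)"
    and "\<And>s. Card_order s \<Longrightarrow> P s \<Longrightarrow> least_card P \<le>o s"
proof -
  have "\<exists>r\<in>{r. Card_order r \<and> P r}. \<forall>s\<in>{r. Card_order r \<and> P r}. r \<le>o s"
    by (rule exists_minim_Card_order) (use assms in auto)
  then have "\<exists>r. Card_order r \<and> P r \<and> (\<forall>s. Card_order s \<and> P s \<longrightarrow> r \<le>o s)"
    by blast
  from someI_ex[OF this]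
  show "Card_order (least_card P)" "P (least_card P)"
    "\<And>s. Card_order s \<Longrightarrow> P s \<Longrightarrow> least_card P \<le>o s"
    unfolding least_card_def by blast+
qed

lemma realise_card:
  fixes s :: "'c rel"
  assumes "Card_order s" "s \<le>o |UNIV :: 'b set|"
  obtains B :: "'b set" where "s =o |B|"
proof -
  have "|Field s| \<le>o |UNIV :: 'b set|"
    using assms card_of_Field_ordIso ordIso_ordLeq_trans by blast
  then obtain B :: "'b set" where "|Field s| =o |B|"
    using iffD1[OF internalize_card_of_ordLeq2] by metis
  with assms(1) have "s =o |B|"
    by (meson card_of_Field_ordIso ordIso_symmetric ordIso_transitive)
  then show thesis by (rule that)
qed

lemma card_Sup_facts:
  fixes \<A> :: "'a set set"
  shows Card_order_card_Sup: "Card_order (card_Sup \<A>)"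
    and card_Sup_upper: "A \<in> \<A> \<Longrightarrow> |A| \<le>o card_Sup \<A>"
    and card_Sup_least_aux: "\<And>s :: 'a rel. Card_order s \<Longrightarrow> \<forall>A\<in>\<A>. |A| \<le>o s \<Longrightarrow> card_Sup \<A> \<le>o s"
proof -
  have "\<forall>A\<in>\<A>. |A| \<le>o |UNIV :: 'a set|"
    by (simp add: card_of_mono1)
  note * = least_card[where P = "\<lambda>r. \<forall>A\<in>\<A>. |A| \<le>o r", OF card_of_Card_order this,
      folded card_Sup_def]
  show "Card_order (card_Sup \<A>)" by (fact *(1))
  show "A \<in> \<A> \<Longrightarrow> |A| \<le>o card_Sup \<A>" using *(2) by blast
  show "\<And>s :: 'a rel. Card_order s \<Longrightarrow> \<forall>A\<in>\<A>. |A| \<le>o s \<Longrightarrow> card_Sup \<A> \<le>o s"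
    by (fact *(3))
qed

lemma card_Sup_least:
  fixes \<A> :: "'a set set" and s :: "'c rel"
  assumes s: "Card_order s" and ub: "\<And>A. A \<in> \<A> \<Longrightarrow> |A| \<le>o s"
  shows "card_Sup \<A> \<le>o s"
proof (cases "s \<le>o |UNIV :: 'a set|")
  case True
  then obtain B :: "'a set" where B: "s =o |B|"
    using realise_card s by blast
  then have "card_Sup \<A> \<le>o |B|"
    using ub ordLeq_ordIso_trans by (blast intro: card_Sup_least_aux card_of_Card_order)
  then show ?thesis
    using B ordIso_symmetric ordLeq_ordIso_trans by blast
next
  case False
  then have "|UNIV :: 'a set| \<le>o s"
    using s by (meson card_of_Well_order card_order_on_well_order_on ordLeq_total)
  moreover have "card_Sup \<A> \<le>o |UNIV :: 'a set|"
    by (rule card_Sup_least_aux) (auto intro: card_of_Card_order card_of_mono1)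
  ultimately show ?thesis
    using ordLeq_transitive by blast
qed

lemma covers_reduce_to_topspace: "covers_reduce_to X |topspace X|"
  unfolding covers_reduce_to_def
proof (intro allI impI)
  fix \<U> assume U: "(\<forall>U\<in>\<U>. openin X U) \<and> \<Union>\<U> = topspace X"
  then have "\<forall>x\<in>topspace X. \<exists>U. U \<in> \<U> \<and> x \<in> U" by blast
  then obtain f where f: "\<forall>x\<in>topspace X. f x \<in> \<U> \<and> x \<in> f x" by metis
  show "\<exists>\<V>\<subseteq>\<U>. \<Union>\<V> = topspace X \<and> |\<V>| \<le>o |topspace X|"
    using U f by (intro exI[of _ "f ` topspace X"]) (auto simp: card_of_image)
qed

lemma covers_reduce_to_mono: "covers_reduce_to X r \<Longrightarrow> r \<le>o s \<Longrightarrow> covers_reduce_to X s"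
  unfolding covers_reduce_to_def by (meson ordLeq_transitive)

lemma Lindelof_degree_facts:
  fixes X :: "'a topology"
  shows Card_order_Lindelof_degree: "Card_order (Lindelof_degree X)"
    and cinfinite_Lindelof_degree: "cinfinite (Lindelof_degree X)"
    and covers_reduce_to_Lindelof_degree: "covers_reduce_to X (Lindelof_degree X)"
    and Lindelof_degree_least_aux: "\<And>s :: ('a + nat) rel.
      Card_order s \<Longrightarrow> cinfinite s \<Longrightarrow> covers_reduce_to X s \<Longrightarrow> Lindelof_degree X \<le>o s"
    and Lindelof_degree_le_UNIV: "Lindelof_degree X \<le>o |UNIV :: ('a + nat) set|"
proof -
  have "|topspace X| \<le>o |UNIV :: ('a + nat) set|"
    by (rule card_of_ordLeqI[of Inl]) auto
  then have "covers_reduce_to X |UNIV :: ('a + nat) set|"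
    using covers_reduce_to_mono covers_reduce_to_topspace by blast
  moreover have "cinfinite |UNIV :: ('a + nat) set|"
    by (simp add: cinfinite_def Field_card_of)
  ultimately have U: "cinfinite |UNIV :: ('a + nat) set| \<and> covers_reduce_to X |UNIV :: ('a + nat) set|"
    by blast
  note * = least_card[where P = "\<lambda>r. cinfinite r \<and> covers_reduce_to X r",
      OF card_of_Card_order U, folded Lindelof_degree_def]
  show "Card_order (Lindelof_degree X)" by (fact *(1))
  show "cinfinite (Lindelof_degree X)" "covers_reduce_to X (Lindelof_degree X)"
    using *(2) by blast+
  show "\<And>s :: ('a + nat) rel.
      Card_order s \<Longrightarrow> cinfinite s \<Longrightarrow> covers_reduce_to X s \<Longrightarrow> Lindelof_degree X \<le>o s"
    using *(3) by blast
  show "Lindelof_degree X \<le>o |UNIV :: ('a + nat) set|"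
    using *(3) U card_of_Card_order by blast
qed

lemma Lindelof_degree_least:
  fixes X :: "'a topology" and s :: "'c rel"
  assumes s: "Card_order s" "cinfinite s" "covers_reduce_to X s"
  shows "Lindelof_degree X \<le>o s"
proof (cases "s \<le>o |UNIV :: ('a + nat) set|")
  case True
  then obtain B :: "('a + nat) set" where B: "s =o |B|"
    using realise_card s by blast
  then have le: "s \<le>o |B|" by (rule ordIso_imp_ordLeq)
  have "Lindelof_degree X \<le>o |B|"
  proof (rule Lindelof_degree_least_aux)
    show "cinfinite |B|" using cinfinite_mono[OF le s(2)] .
    show "covers_reduce_to X |B|" using covers_reduce_to_mono[OF s(3) le] .
  qed (rule card_of_Card_order)
  then show ?thesis
    using B ordIso_symmetric ordLeq_ordIso_trans by blast
next
  case False
  then have "|UNIV :: ('a + nat) set| \<le>o s"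
    using s by (meson card_of_Well_order card_order_on_well_order_on ordLeq_total)
  then show ?thesis
    using Lindelof_degree_le_UNIV ordLeq_transitive by blast
qed

lemma free_sequence_inj_on:
  assumes "free_sequence X r x"
  shows "inj_on x (Field r)"
proof -
  have wo: "Well_order r" and sub: "x ` Field r \<subseteq> topspace X"
    and dis: "\<And>b. b \<in> Field r \<Longrightarrow> X closure_of (x ` underS r b) \<inter> X closure_of (x ` above r b) = {}"
    using assms unfolding free_sequence_def by auto
  have neq: "x a \<noteq> x b" if ab: "(a, b) \<in> r" "a \<noteq> b" for a b
  proof -
    have F: "a \<in> Field r" "b \<in> Field r" using ab by (auto simp: Field_def)
    have "(b, b) \<in> r"
      using wo F unfolding well_order_on_def linear_order_on_def partial_order_on_def
        preorder_on_def refl_on_def by blast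
    then have "x b \<in> x ` above r b" by (auto simp: above_def)
    moreover have "x a \<in> x ` underS r b" using ab by (auto simp: underS_def)
    moreover have "x ` underS r b \<subseteq> topspace X" "x ` above r b \<subseteq> topspace X"
      using sub by (auto simp: underS_def above_def Field_def)
    ultimately show ?thesis
      using dis[OF F(2)] closure_of_subset by (metis disjoint_iff in_mono)
  qed
  show ?thesis
  proof (rule inj_onI, rule ccontr)
    fix a b assume "a \<in> Field r" "b \<in> Field r" "x a = x b" "a \<noteq> b"
    moreover from this have "(a, b) \<in> r \<or> (b, a) \<in> r"
      using wo unfolding well_order_on_def linear_order_on_def total_on_def by blast
    ultimately show False using neq by metis
  qed
qed

lemma free_sequence_transfer:
  fixes r :: "'i rel"
  assumes "free_sequence X r x"
  shows "free_sequence X (dir_image r x) id" and "Field (dir_image r x) = x ` Field r"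
proof -
  have wo: "Well_order r" using assms unfolding free_sequence_def by blast
  have inj: "inj_on x (Field r)" using assms by (rule free_sequence_inj_on)
  show F: "Field (dir_image r x) = x ` Field r" by (rule dir_image_Field)
  have dir: "(x a, x b) \<in> dir_image r x \<longleftrightarrow> (a, b) \<in> r" if "a \<in> Field r" "b \<in> Field r" for a b
  proof
    assume "(x a, x b) \<in> dir_image r x"
    then obtain a' b' where *: "x a = x a'" "x b = x b'" "(a', b') \<in> r"
      unfolding dir_image_def by blast
    then have "a' \<in> Field r" "b' \<in> Field r" by (auto intro: FieldI1 FieldI2)
    then have "a = a'" "b = b'" using * that inj_onD[OF inj] by blast+
    then show "(a, b) \<in> r" using * by blast
  qed (auto simp: dir_image_def)
  have Fi: "y \<in> x ` Field r" if "(y, z) \<in> dir_image r x \<or> (z, y) \<in> dir_image r x" for y z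
    using that F by (metis FieldI1 FieldI2)
  have images: "underS (dir_image r x) (x b) = x ` underS r b"
    "above (dir_image r x) (x b) = x ` above r b" if b: "b \<in> Field r" for b
  proof -
    show "underS (dir_image r x) (x b) = x ` underS r b"
    proof (intro equalityI subsetI)
      fix y assume "y \<in> underS (dir_image r x) (x b)"
      then have y: "y \<noteq> x b" "(y, x b) \<in> dir_image r x" by (auto simp: underS_def)
      then obtain a where "a \<in> Field r" "y = x a" using Fi by blast
      then show "y \<in> x ` underS r b" using y dir[of a b] b by (auto simp: underS_def)
    next
      fix y assume "y \<in> x ` underS r b"
      then obtain a where a: "y = x a" "a \<noteq> b" "(a, b) \<in> r" by (auto simp: underS_def)
      then have "a \<in> Field r" by (auto intro: FieldI1)
      then show "y \<in> underS (dir_image r x) (x b)"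
        using a b dir[of a b] inj_onD[OF inj] by (auto simp: underS_def)
    qed
    show "above (dir_image r x) (x b) = x ` above r b"
    proof (intro equalityI subsetI)
      fix y assume "y \<in> above (dir_image r x) (x b)"
      then have y: "(x b, y) \<in> dir_image r x" by (auto simp: above_def)
      then obtain a where "a \<in> Field r" "y = x a" using Fi by blast
      then show "y \<in> x ` above r b" using y dir[of b a] b by (auto simp: above_def)
    next
      fix y assume "y \<in> x ` above r b"
      then obtain a where a: "y = x a" "(b, a) \<in> r" by (auto simp: above_def)
      then have "a \<in> Field r" by (auto intro: FieldI2)
      then show "y \<in> above (dir_image r x) (x b)"
        using a b dir[of b a] by (auto simp: above_def)
    qed
  qed
  show "free_sequence X (dir_image r x) id"
    using assms Well_order_dir_image[OF wo inj] unfolding free_sequence_def F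
    by (simp add: images)
qed

lemma free_sequence_number_upper:
  fixes r :: "'i rel"
  assumes "free_sequence X r x"
  shows "|Field r| \<le>o free_sequence_number X"
proof -
  have "x ` Field r = id ` Field (dir_image r x)"
    by (simp add: free_sequence_transfer(2)[OF assms])
  then have "|x ` Field r| \<le>o free_sequence_number X"
    unfolding free_sequence_number_def
    using free_sequence_transfer(1)[OF assms] by (intro card_Sup_upper) blast
  moreover have "|Field r| \<le>o |x ` Field r|"
    using free_sequence_inj_on[OF assms] card_of_ordLeq by blast
  ultimately show ?thesis
    using ordLeq_transitive by blast
qed

end

theory Submission
  imports Defs
begin

text \<open>
  Write \<open>g\<close> for the depth and put \<open>\<kappa> = L(X) \<cdot> F(X)\<close>, \<open>\<lambda> = g^\<kappa>\<close>. In a Hausdorff space every point is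
  the intersection of at most \<open>g\<close> open sets: Shapirovskii's selection of a discrete set \<open>D\<close> shows that
  the complement of \<open>p\<close> is covered by the closures of \<open>|closure D|\<close> open sets that do not have \<open>p\<close> in
  their closure. A closing-off argument then yields a set \<open>A\<close> of size at most \<open>\<lambda>\<close> that contains the
  closure of each of its discrete subsets of size at most \<open>\<kappa>\<close>, and meets the complement of the union
  of any \<open>\<kappa>\<close> of the chosen neighbourhoods of its points unless that complement is empty. If a point
  \<open>q\<close> were outside \<open>A\<close>, choosing for each point of \<open>A\<close> a neighbourhood missing \<open>q\<close> would allow one to
  build a free sequence in \<open>A\<close> of length \<open>\<kappa>\<^sup>+\<close>: the closure of an initial segment is covered by \<open>\<kappa>\<close>
  of these neighbourhoods, and the next point is taken outside of them.
\<close>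

section \<open>Recursion along well-orders and cardinal bounds\<close>

text \<open>Greedy selection: whether \<open>y\<close> is accepted depends, through
  \<open>P\<close>, on the members already accepted below it. This is well-founded recursion on the
  characteristic function.\<close>

lemma wf_recursive_subset:
  assumes "wf R"
  obtains D where "\<And>y. y \<in> D \<longleftrightarrow> P y {z \<in> D. (z, y) \<in> R}"
proof -
  define f where "f = wfrec R (\<lambda>g y. P y {z. (z, y) \<in> R \<and> g z})"
  have "f y = P y {z. (z, y) \<in> R \<and> f z}" for y
  proof -
    have "{z. (z, y) \<in> R \<and> cut f R y z} = {z. (z, y) \<in> R \<and> f z}"
      by (auto simp: cut_def)
    then show ?thesis
      unfolding f_def by (subst wfrec[OF assms]) simp
  qed
  then have "y \<in> Collect f \<longleftrightarrow> P y {z \<in> Collect f. (z, y) \<in> R}" for y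
    by (metis (mono_tags, lifting) Collect_cong mem_Collect_eq)
  then show thesis by (rule that)
qed

lemma card_of_subset_ordLeq: "A \<subseteq> B \<Longrightarrow> |B| \<le>o r \<Longrightarrow> |A| \<le>o r"
  by (rule ordLeq_transitive[OF card_of_mono1])

lemma card_of_image_ordLeq: "|A| \<le>o r \<Longrightarrow> |f ` A| \<le>o r"
  by (rule ordLeq_transitive[OF card_of_image])

text \<open>A nonempty subset of size at most \<open>k\<close> is the range of a function from
  \<open>Field k\<close> to \<open>B\<close>, and there are at most \<open>l ^c k\<close> such
  functions.\<close>

lemma card_of_bounded_subsets:
  fixes B :: "'b set"
  assumes l: "Cinfinite l" and exp: "l ^c k \<le>o l" and k: "Card_order k" and B: "|B| \<le>o l"
  shows "|{V. V \<subseteq> B \<and> |V| \<le>o k}| \<le>o l"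
proof -
  let ?F = "Func (Field k) B"
  have "|?F| \<le>o l"
  proof -
    have "|?F| = |B| ^c k" by (simp add: cexp_def Field_card_of)
    then show ?thesis
      using cexp_mono1[OF B k] exp ordLeq_transitive by metis
  qed
  then have "|(\<lambda>f. f ` Field k) ` ?F| \<le>o l"
    by (rule card_of_image_ordLeq)
  moreover have "|{{}} :: 'b set set| \<le>o l"
    using l by (intro Card_order_singl_ordLeq) (auto simp: cinfinite_def)
  ultimately have "|{{}} \<union> (\<lambda>f. f ` Field k) ` ?F| \<le>o l"
    using l by (intro Un_Cinfinite_bound)
  moreover have "{V. V \<subseteq> B \<and> |V| \<le>o k} \<subseteq> {{}} \<union> (\<lambda>f. f ` Field k) ` ?F"
  proof
    fix V assume "V \<in> {V. V \<subseteq> B \<and> |V| \<le>o k}"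
    then have V: "V \<subseteq> B" "|V| \<le>o k" by auto
    show "V \<in> {{}} \<union> (\<lambda>f. f ` Field k) ` ?F"
    proof (cases "V = {}")
      case False
      have "|V| \<le>o |Field k|"
        using V(2) card_of_Field_ordIso[OF k] ordIso_symmetric ordLeq_ordIso_trans by blast
      then obtain h where h: "h ` Field k = V"
        using card_of_ordLeq2[OF False] by metis
      \<comment> \<open>Members of \<open>Func\<close> must be \<open>undefined\<close> off their
        domain.\<close>
      define f where "f = (\<lambda>x. if x \<in> Field k then h x else undefined)"
      have "f ` Field k = V" using h by (auto simp: f_def)
      moreover have "f \<in> ?F" using h V(1) by (auto simp: f_def Func_def)
      ultimately show ?thesis by blast
    qed simp
  qed
  ultimately show ?thesis
    by (rule card_of_subset_ordLeq[rotated])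
qed

lemma Well_order_cardSuc: "Card_order r \<Longrightarrow> Well_order (cardSuc r)"
  using cardSuc_Card_order card_order_on_well_order_on by blast

lemma wf_cardSuc: "Card_order r \<Longrightarrow> wf (cardSuc r - Id)"
  using Well_order_cardSuc well_order_on_def by blast

lemma card_of_underS_cardSuc:
  assumes "Card_order r" "a \<in> Field (cardSuc r)"
  shows "|underS (cardSuc r) a| \<le>o r"
  using card_of_underS[OF cardSuc_Card_order assms(2)] cardSuc_ordLeq_ordLess assms(1)
    card_of_Card_order by blast

lemma card_of_under_cardSuc:
  assumes r: "Cinfinite r" and a: "a \<in> Field (cardSuc r)"
  shows "|under (cardSuc r) a| \<le>o r"
proof -
  have "under (cardSuc r) a \<subseteq> underS (cardSuc r) a \<union> {a}"
    by (auto simp: under_def underS_def)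
  moreover have "|{a}| \<le>o r"
    using r by (intro Card_order_singl_ordLeq) (auto simp: cinfinite_def)
  then have "|underS (cardSuc r) a \<union> {a}| \<le>o r"
    using card_of_underS_cardSuc r a by (intro Un_Cinfinite_bound) auto
  ultimately show ?thesis
    by (rule card_of_subset_ordLeq)
qed

text \<open>Stages are iterated along \<open>cardSuc k\<close>. Each stage stays within
  \<open>l\<close> because there are at most \<open>l ^c k\<close> small subsets to treat, and by
  regularity every small subset of \<open>A\<close> already lies in an earlier part of the
  construction.\<close>

lemma closing_off:
  fixes H :: "'a set \<Rightarrow> 'a set"
  assumes l: "Cinfinite l" and exp: "l ^c k \<le>o l" and k: "Cinfinite k" and kl: "cardSuc k \<le>o l"
    and H: "\<And>S. |S| \<le>o k \<Longrightarrow> |H S| \<le>o l"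
  obtains A where "|A| \<le>o l" "A \<subseteq> \<Union>(range H)" "\<And>S. S \<subseteq> A \<Longrightarrow> |S| \<le>o k \<Longrightarrow> H S \<subseteq> A"
proof -
  let ?r = "cardSuc k"
  define step where "step B = \<Union>(H ` {S. S \<subseteq> B \<and> |S| \<le>o k})" for B
  define f where "f = wfrec (?r - Id) (\<lambda>g a. step (\<Union>(g ` underS ?r a)))"
  have wf: "wf (?r - Id)" using k wf_cardSuc by blast
  have f: "f a = step (\<Union>(f ` underS ?r a))" for a
  proof -
    have "cut f (?r - Id) a ` underS ?r a = f ` underS ?r a"
      by (intro image_cong) (auto simp: cut_def underS_def)
    then show ?thesis
      unfolding f_def by (subst wfrec[OF wf]) simp
  qed
  have step: "|step B| \<le>o l" if "|B| \<le>o l" for B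
    unfolding step_def using card_of_bounded_subsets[OF l exp _ that] k H l
    by (intro UNION_Cinfinite_bound) auto
  have k_le_l: "k \<le>o l" using kl k cardSuc_ordLeq ordLeq_transitive by blast
  have fl: "a \<in> Field ?r \<longrightarrow> |f a| \<le>o l" for a
  proof (induction a rule: wf_induct_rule[OF wf])
    case (1 a)
    show ?case
    proof
      assume a: "a \<in> Field ?r"
      have "|\<Union>(f ` underS ?r a)| \<le>o l"
      proof (intro UNION_Cinfinite_bound ballI l)
        show "|underS ?r a| \<le>o l"
          using card_of_underS_cardSuc a k k_le_l ordLeq_transitive by blast
        fix b assume "b \<in> underS ?r a"
        then show "|f b| \<le>o l" using 1 by (auto simp: underS_def Field_def)
      qed
      then show "|f a| \<le>o l" using step f by metis
    qed
  qed
  define A where "A = \<Union>(f ` Field ?r)"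
  show thesis
  proof
    have "|Field ?r| \<le>o l"
      using kl k cardSuc_Card_order card_of_Field_ordIso ordIso_ordLeq_trans by blast
    then show "|A| \<le>o l" unfolding A_def using fl l UNION_Cinfinite_bound by blast
    have "f a \<subseteq> \<Union>(range H)" for a by (subst f) (auto simp: step_def)
    then show "A \<subseteq> \<Union>(range H)" by (auto simp: A_def)
  next
    fix S assume S: "S \<subseteq> A" "|S| \<le>o k"
    \<comment> \<open>By transitivity the unions over initial segments form a chain, which is the
      form in which regularity of \<open>cardSuc k\<close> is applied.\<close>
    define C where "C a = \<Union>(f ` under ?r a)" for a
    have wo: "Well_order ?r" using k Well_order_cardSuc by blast
    then have tr: "trans ?r" and re: "refl_on (Field ?r) ?r"
      by (auto simp: well_order_on_def linear_order_on_def partial_order_on_def preorder_on_def)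
    have "relChain ?r C"
      unfolding relChain_def C_def using tr by (fastforce simp: under_def dest: transD)
    moreover have "S \<subseteq> (\<Union>a\<in>Field ?r. C a)"
      using S(1) re unfolding A_def C_def by (fastforce simp: under_def dest: refl_onD)
    ultimately obtain a where a: "a \<in> Field ?r" "S \<subseteq> C a"
      using cardSuc_UNION k S(2) unfolding cinfinite_def by metis
    \<comment> \<open>Stage \<open>b\<close> treats only what was built strictly before it, so some
      \<open>b\<close> after \<open>a\<close> is required; an infinite cardinal has no last
      element.\<close>
    have "infinite (Field ?r)" using Cinfinite_cardSuc[OF k] by (simp add: cinfinite_def)
    then obtain b where b: "b \<in> Field ?r" "a \<noteq> b" "(a, b) \<in> ?r"
      using infinite_Card_order_limit[OF cardSuc_Card_order] a(1) k by metis
    have "under ?r a \<subseteq> underS ?r b"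
      using b tr wo by (auto simp: under_def underS_def well_order_on_def linear_order_on_def
          partial_order_on_def dest: transD antisymD)
    then have "S \<subseteq> \<Union>(f ` underS ?r b)" 
      using a(2) unfolding C_def by (meson Union_mono image_mono order_trans)
    then have "H S \<subseteq> f b" using S(2) by (subst f) (auto simp: step_def)
    then show "H S \<subseteq> A" using b(1) by (auto simp: A_def)
  qed
qed

section \<open>Discrete sets and pseudocharacter\<close>

lemma discrete_subsetI:
  assumes "D \<subseteq> topspace X" and "\<And>x. x \<in> D \<Longrightarrow> \<exists>U. openin X U \<and> U \<inter> D = {x}"
  shows "discrete_subset X D"
proof -
  have "openin (subtopology X D) {x}" if "x \<in> D" for x
    using assms(2)[OF that] by (auto simp: openin_subtopology)
  then have "discrete_topology D = subtopology X D"
    using assms(1) by (auto simp: discrete_topology_unique)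
  then show ?thesis using assms(1) by (simp add: discrete_subset_def)
qed

lemma card_closure_of_discrete_le_depth:
  "discrete_subset X D \<Longrightarrow> |X closure_of D| \<le>o depth X"
  unfolding depth_def by (rule card_Sup_upper) blast

lemma Card_order_depth: "Card_order (depth X)"
  unfolding depth_def by (rule Card_order_card_Sup)

lemma discrete_subset_singleton: "x \<in> topspace X \<Longrightarrow> discrete_subset X {x}"
  by (rule discrete_subsetI) auto

text \<open>Run through a well-order and accept a point of \<open>Y\<close> unless it lies in the
  closure of the points accepted so far or in one of their neighbourhoods \<open>V\<close>. Rejected
  points are thereby covered.\<close>

lemma Shapirovskii_discrete:
  assumes Y: "Y \<subseteq> topspace X" and V: "\<And>y. y \<in> Y \<Longrightarrow> openin X (V y) \<and> y \<in> V y"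
  obtains D where "D \<subseteq> Y" "discrete_subset X D" "Y \<subseteq> X closure_of D \<union> \<Union>(V ` D)"
proof -
  obtain R :: "'a rel" where R: "Well_order R" "Field R = UNIV"
    using well_ordering by metis
  then have "wf (R - Id)" by (simp add: well_order_on_def)
  then obtain D where D: "\<And>y. y \<in> D \<longleftrightarrow>
      y \<in> Y \<and> y \<notin> X closure_of {z \<in> D. (z, y) \<in> R - Id} \<union> \<Union>(V ` {z \<in> D. (z, y) \<in> R - Id})"
    by (rule wf_recursive_subset[where
        P = "\<lambda>y E. y \<in> Y \<and> y \<notin> X closure_of E \<union> \<Union>(V ` E)"]) blast
  have tot: "(y, z) \<in> R - Id \<or> (z, y) \<in> R - Id" if "y \<noteq> z" for y z
    using R that by (auto simp: well_order_on_def linear_order_on_def total_on_def)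
  show thesis
  proof
    show DY: "D \<subseteq> Y" using D by blast
    show "discrete_subset X D"
    proof (rule discrete_subsetI)
      show "D \<subseteq> topspace X" using DY Y by blast
      fix y assume y: "y \<in> D"
      define E where "E = {z \<in> D. (z, y) \<in> R - Id}"
      have yE: "y \<notin> X closure_of E" using D[of y] y unfolding E_def by blast
      have "E \<subseteq> X closure_of E"
        using DY Y by (intro closure_of_subset) (auto simp: E_def)
      moreover have "z \<notin> V y" if "z \<in> D" "z \<noteq> y" "z \<notin> E" for z
      proof -
        have "(y, z) \<in> R - Id" using tot[of y z] that by (auto simp: E_def)
        then show ?thesis using D[of z] y that(1) by blast
      qed
      \<comment> \<open>Earlier members are removed with the closure of \<open>E\<close>; later ones
        were accepted only because they avoid \<open>V y\<close>.\<close>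
      ultimately have "(V y - X closure_of E) \<inter> D = {y}"
        using y yE V DY by blast
      moreover have "openin X (V y - X closure_of E)"
        using V y DY by (auto intro!: openin_diff)
      ultimately show "\<exists>U. openin X U \<and> U \<inter> D = {y}" by blast
    qed
    show "Y \<subseteq> X closure_of D \<union> \<Union>(V ` D)"
    proof
      fix y assume y: "y \<in> Y"
      have "X closure_of {z \<in> D. (z, y) \<in> R - Id} \<subseteq> X closure_of D"
        by (rule closure_of_mono) blast
      then show "y \<in> X closure_of D \<union> \<Union>(V ` D)"
        using D[of y] y V by blast
    qed
  qed
qed

lemma Hausdorff_pseudobase_le_depth:
  assumes X: "Hausdorff_space X" and p: "p \<in> topspace X"
  obtains N where "|N| \<le>o depth X" "\<And>U. U \<in> N \<Longrightarrow> openin X U \<and> p \<in> U"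
    "\<And>q. q \<in> topspace X \<Longrightarrow> q \<noteq> p \<Longrightarrow> \<exists>U\<in>N. q \<notin> U"
proof -
  have "\<exists>V. openin X V \<and> y \<in> V \<and> p \<notin> X closure_of V" if y: "y \<in> topspace X - {p}" for y
  proof -
    obtain U V where UV: "openin X U" "openin X V" "p \<in> U" "y \<in> V" "disjnt U V"
      using X p y unfolding Hausdorff_space_def by (metis Diff_iff singletonI)
    then have "p \<notin> X closure_of V" by (auto simp: in_closure_of disjnt_iff)
    then show ?thesis using UV by blast
  qed
  then obtain V where V: "\<And>y. y \<in> topspace X - {p} \<Longrightarrow>
      openin X (V y) \<and> y \<in> V y \<and> p \<notin> X closure_of (V y)"
    by metis
  obtain D where D: "D \<subseteq> topspace X - {p}" "discrete_subset X D"
      "topspace X - {p} \<subseteq> X closure_of D \<union> \<Union>(V ` D)"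
    using Shapirovskii_discrete[of "topspace X - {p}" X V] V by blast
  \<comment> \<open>Indexing by the closure of \<open>D\<close> and not by \<open>D\<close> alone
    handles points of the closure outside all \<open>V\<close> of \<open>D\<close>: such a
    \<open>q\<close> lies in its own \<open>V q\<close>. The point \<open>p\<close> is left out
    since \<open>V\<close> is specified only away from it.\<close>
  define I where "I = X closure_of D - {p}"
  have I: "I \<subseteq> topspace X - {p}" using closure_of_subset_topspace by (fastforce simp: I_def)
  have DI: "D \<subseteq> I"
    using D(1) closure_of_subset[of D X] by (auto simp: I_def)
  define N where "N = (\<lambda>y. topspace X - X closure_of (V y)) ` I"
  show thesis
  proof
    have "|I| \<le>o depth X"
      using card_closure_of_discrete_le_depth[OF D(2)]
      by (rule card_of_subset_ordLeq[rotated]) (auto simp: I_def)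
    then show "|N| \<le>o depth X"
      unfolding N_def by (rule card_of_image_ordLeq)
    show "openin X U \<and> p \<in> U" if "U \<in> N" for U
      using that I V p by (auto simp: N_def)
    fix q assume q: "q \<in> topspace X" "q \<noteq> p"
    then obtain y where y: "y \<in> I" "q \<in> V y"
      using D(3) DI V by (cases "q \<in> X closure_of D") (fastforce simp: I_def)+
    have "V y \<subseteq> X closure_of V y"
      using V y(1) I openin_subset by (intro closure_of_subset) blast
    then show "\<exists>U\<in>N. q \<notin> U" using y by (auto simp: N_def)
  qed
qed

section \<open>Covering closed sets and building free sequences\<close>

text \<open>The complement of \<open>C\<close> is added to obtain a cover of the whole space, and
  dropped again from the subcover.\<close>

lemma covers_reduce_to_closedin:
  assumes X: "covers_reduce_to X k" and C: "closedin X C"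
    and \<U>: "\<And>U. U \<in> \<U> \<Longrightarrow> openin X U" "C \<subseteq> \<Union>\<U>"
  obtains \<V> where "\<V> \<subseteq> \<U>" "|\<V>| \<le>o k" "C \<subseteq> \<Union>\<V>"
proof -
  have "\<forall>U\<in>insert (topspace X - C) \<U>. openin X U"
    using \<U>(1) C by blast
  moreover have "\<Union>\<U> \<subseteq> topspace X"
    using \<U>(1) openin_subset by blast
  then have "\<Union>(insert (topspace X - C) \<U>) = topspace X"
    using \<U>(2) by blast
  ultimately obtain \<W> where \<W>: "\<W> \<subseteq> insert (topspace X - C) \<U>" "\<Union>\<W> = topspace X" "|\<W>| \<le>o k"
    using X unfolding covers_reduce_to_def by metis
  show thesis
  proof
    show "\<W> - {topspace X - C} \<subseteq> \<U>" using \<W>(1) by blast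
    show "|\<W> - {topspace X - C}| \<le>o k"
      using \<W>(3) by (rule card_of_subset_ordLeq[rotated]) blast
    show "C \<subseteq> \<Union>(\<W> - {topspace X - C})"
      using \<W>(2) closedin_subset[OF C] by blast
  qed
qed

text \<open>At stage \<open>a\<close> the point is taken outside covers of the closures of all
  initial segments up to that of \<open>a\<close>. These are at most \<open>k\<close> covers of at
  most \<open>k\<close> sets each, so \<open>c\<close> still applies.\<close>

lemma free_sequence_cardSuc:
  assumes k: "Cinfinite k" and L: "covers_reduce_to X k" and A: "A \<subseteq> topspace X"
    and u: "\<And>p. p \<in> A \<Longrightarrow> openin X (u p) \<and> p \<in> u p"
    and cl: "\<And>D. D \<subseteq> A \<Longrightarrow> |D| \<le>o k \<Longrightarrow> discrete_subset X D \<Longrightarrow> X closure_of D \<subseteq> A"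
    and c: "\<And>\<V>. \<V> \<subseteq> u ` A \<Longrightarrow> |\<V>| \<le>o k \<Longrightarrow> c \<V> \<in> A - \<Union>\<V>"
  obtains x where "free_sequence X (cardSuc k) x"
proof -
  let ?r = "cardSuc k"
  have wo: "Well_order ?r" and wf: "wf (?r - Id)"
    using k Well_order_cardSuc wf_cardSuc by blast+
  then have tr: "trans ?r" and re: "refl_on (Field ?r) ?r" and an: "antisym ?r"
    and tot: "total_on (Field ?r) ?r"
    by (auto simp: well_order_on_def linear_order_on_def partial_order_on_def preorder_on_def)
  \<comment> \<open>Including \<open>u ` T\<close> in the cover keeps later points out of \<open>u (x b)\<close>, so that \<open>x b\<close> stays isolated
    and initial segments are discrete.\<close>
  have "\<exists>\<W>. \<W> \<subseteq> u ` A \<and> u ` T \<subseteq> \<W> \<and> |\<W>| \<le>o k \<and> X closure_of T \<subseteq> \<Union>\<W>"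
    if T: "T \<subseteq> A" "|T| \<le>o k" "X closure_of T \<subseteq> A" for T
  proof -
    have "X closure_of T \<subseteq> \<Union>(u ` A)" using T(3) u by blast
    then obtain \<W> where \<W>: "\<W> \<subseteq> u ` A" "|\<W>| \<le>o k" "X closure_of T \<subseteq> \<Union>\<W>"
      using covers_reduce_to_closedin[OF L closedin_closure_of, where \<U> = "u ` A"] u by blast
    have "|u ` T| \<le>o k" using T(2) by (rule card_of_image_ordLeq)
    then have "|\<W> \<union> u ` T| \<le>o k" using \<W>(2) k by (intro Un_Cinfinite_bound)
    then show ?thesis using \<W> T(1) by (intro exI[of _ "\<W> \<union> u ` T"]) auto
  qed
  then obtain w where w: "\<And>T. T \<subseteq> A \<Longrightarrow> |T| \<le>o k \<Longrightarrow> X closure_of T \<subseteq> A \<Longrightarrow>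
      w T \<subseteq> u ` A \<and> u ` T \<subseteq> w T \<and> |w T| \<le>o k \<and> X closure_of T \<subseteq> \<Union>(w T)"
    by metis
  \<comment> \<open>The index \<open>b = a\<close> is included, so the new point also avoids the
    cover for everything before it. Only values of \<open>g\<close> strictly below \<open>a\<close>
    are read.\<close>
  define x where "x = wfrec (?r - Id) (\<lambda>g a. c (\<Union>b\<in>under ?r a. w (g ` underS ?r b)))"
  define \<W> where "\<W> a = (\<Union>b\<in>under ?r a. w (x ` underS ?r b))" for a
  have x: "x a = c (\<W> a)" for a
  proof -
    have "cut x (?r - Id) a ` underS ?r b = x ` underS ?r b" if "b \<in> under ?r a" for b
      using that tr an
      by (intro image_cong) (auto simp: cut_def underS_def under_def dest: transD antisymD)
    then show ?thesis
      unfolding x_def \<W>_def by (subst wfrec[OF wf]) (auto simp: x_def[symmetric])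
  qed
  \<comment> \<open>The claims need one induction: avoidance at earlier stages gives discreteness,
    discreteness puts the closure into \<open>A\<close>, and only then is the next cover
    available.\<close>
  have good: "a \<in> Field ?r \<longrightarrow> X closure_of (x ` underS ?r a) \<subseteq> A \<and> x a \<in> A \<and> x a \<notin> \<Union>(\<W> a)" for a
  proof (induction a rule: wf_induct_rule[OF wf])
    case (1 a)
    show ?case
    proof
      assume a: "a \<in> Field ?r"
      have IH: "X closure_of (x ` underS ?r b) \<subseteq> A" "x b \<in> A" "x b \<notin> \<Union>(\<W> b)"
        if "b \<in> underS ?r a" for b
        using 1[of b] that by (auto simp: underS_def intro: FieldI1)
      have small: "|x ` underS ?r b| \<le>o k" if "b \<in> Field ?r" for b
        using card_of_underS_cardSuc[OF _ that] k by (intro card_of_image_ordLeq) blast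
      have sub: "underS ?r b \<subseteq> underS ?r a" if "b \<in> under ?r a" for b
        using that tr an by (auto simp: underS_def under_def dest: transD antisymD)
      have ranA: "x ` underS ?r a \<subseteq> A" using IH by blast
      \<comment> \<open>For \<open>b = a\<close> the inclusion of the closure in \<open>A\<close> is
        not yet known, so it stays a premise; for smaller \<open>b\<close> it comes from the
        induction hypothesis.\<close>
      have W: "w (x ` underS ?r b) \<subseteq> u ` A" "u ` x ` underS ?r b \<subseteq> w (x ` underS ?r b)"
          "|w (x ` underS ?r b)| \<le>o k" "X closure_of (x ` underS ?r b) \<subseteq> \<Union>(w (x ` underS ?r b))"
        if "b \<in> under ?r a" "X closure_of (x ` underS ?r b) \<subseteq> A" for b
      proof -
        have "b \<in> Field ?r" using that by (auto simp: under_def intro: FieldI1)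
        then show "w (x ` underS ?r b) \<subseteq> u ` A" "u ` x ` underS ?r b \<subseteq> w (x ` underS ?r b)"
          "|w (x ` underS ?r b)| \<le>o k" "X closure_of (x ` underS ?r b) \<subseteq> \<Union>(w (x ` underS ?r b))"
          using w[OF _ small that(2)] sub[OF that(1)] ranA by blast+
      qed
      have "discrete_subset X (x ` underS ?r a)"
      proof (rule discrete_subsetI)
        show "x ` underS ?r a \<subseteq> topspace X" using ranA A by blast
        fix y assume "y \<in> x ` underS ?r a"
        then obtain b where b: "b \<in> underS ?r a" "y = x b" by blast
        have bF: "b \<in> Field ?r" and bu: "b \<in> under ?r a"
          using b by (auto simp: underS_def under_def intro: FieldI1)
        have "b \<in> under ?r b" using re bF by (auto simp: under_def dest: refl_onD)
        then have "x b \<notin> X closure_of (x ` underS ?r b)"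
          using IH(3)[OF b(1)] W(4)[OF bu IH(1)[OF b(1)]] by (auto simp: \<W>_def)
        moreover have "x d \<notin> u (x b)" if d: "d \<in> underS ?r a" "d \<noteq> b" "d \<notin> underS ?r b" for d
        proof -
          have dF: "d \<in> Field ?r" and du: "d \<in> under ?r a"
            using d by (auto simp: underS_def under_def intro: FieldI1)
          then have "b \<in> underS ?r d"
            using tot bF d by (auto simp: total_on_def underS_def)
          then have "u (x b) \<in> w (x ` underS ?r d)"
            using W(2)[OF du IH(1)[OF d(1)]] by blast
          moreover have "d \<in> under ?r d" using re dF by (auto simp: under_def dest: refl_onD)
          ultimately have "u (x b) \<in> \<W> d" by (auto simp: \<W>_def)
          then show ?thesis using IH(3)[OF d(1)] by blast
        qed
        moreover have "x ` underS ?r b \<subseteq> X closure_of (x ` underS ?r b)"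
          using sub[OF bu] ranA A by (intro closure_of_subset) blast
        \<comment> \<open>Points before \<open>x b\<close> are removed with the closure, and later
          points lie outside \<open>u (x b)\<close>.\<close>
        ultimately have "(u (x b) - X closure_of (x ` underS ?r b)) \<inter> x ` underS ?r a = {x b}"
          using u[OF IH(2)[OF b(1)]] b by blast
        moreover have "openin X (u (x b) - X closure_of (x ` underS ?r b))"
          using u[OF IH(2)[OF b(1)]] by (auto intro!: openin_diff)
        ultimately show "\<exists>U. openin X U \<and> U \<inter> x ` underS ?r a = {y}"
          using b(2) by blast
      qed
      then have clA: "X closure_of (x ` underS ?r a) \<subseteq> A"
        using cl[OF ranA small[OF a]] by blast
      have clb: "X closure_of (x ` underS ?r b) \<subseteq> A" if "b \<in> under ?r a" for b
        by (rule order_trans[OF closure_of_mono[OF image_mono[OF sub[OF that]]] clA])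
      have "|\<W> a| \<le>o k"
        unfolding \<W>_def using card_of_under_cardSuc[OF k a] W(3) clb k
        by (intro UNION_Cinfinite_bound) auto
      moreover have "\<W> a \<subseteq> u ` A" unfolding \<W>_def using W(1) clb by blast
      ultimately have "x a \<in> A - \<Union>(\<W> a)" using c x by simp
      with clA show "X closure_of (x ` underS ?r a) \<subseteq> A \<and> x a \<in> A \<and> x a \<notin> \<Union>(\<W> a)"
        by blast
    qed
  qed
  have "free_sequence X ?r x"
    unfolding free_sequence_def
  proof (intro conjI ballI wo)
    show "x ` Field ?r \<subseteq> topspace X" using good A by blast
    fix b assume b: "b \<in> Field ?r"
    define T where "T = x ` underS ?r b"
    have "|T| \<le>o k"
      unfolding T_def using card_of_underS_cardSuc[OF _ b] k by (intro card_of_image_ordLeq) blast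
    moreover have "T \<subseteq> A" unfolding T_def using good by (auto simp: underS_def intro: FieldI1)
    moreover have "X closure_of T \<subseteq> A" unfolding T_def using good b by blast
    ultimately have T: "w T \<subseteq> u ` A" "X closure_of T \<subseteq> \<Union>(w T)" using w by blast+
    \<comment> \<open>An open set that misses the tail of the sequence also misses the closure of
      the tail.\<close>
    have "openin X (\<Union>(w T))" using T(1) u by blast
    moreover have "x d \<notin> \<Union>(w T)" if "d \<in> above ?r b" for d
    proof -
      have "d \<in> Field ?r" "b \<in> under ?r d"
        using that by (auto simp: above_def under_def intro: FieldI2)
      then show ?thesis using good[of d] unfolding \<W>_def T_def by blast
    qed
    then have "\<Union>(w T) \<inter> x ` above ?r b = {}" by blast
    ultimately have "\<Union>(w T) \<inter> X closure_of (x ` above ?r b) = {}"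
      by (simp add: openin_Int_closure_of_eq_empty)
    then show "X closure_of (x ` underS ?r b) \<inter> X closure_of (x ` above ?r b) = {}"
      using T(2) by (auto simp: T_def)
  qed
  then show thesis by (rule that)
qed

section \<open>Assembling the cardinal inequality\<close>

lemma Cnotzero_free_sequence_number:
  assumes p: "p \<in> topspace X"
  shows "Cnotzero (free_sequence_number X)"
proof -
  have "Well_order {(p, p)}"
    by (auto simp: well_order_on_def linear_order_on_def partial_order_on_def preorder_on_def
        refl_on_def trans_def antisym_def total_on_def Field_def)
  moreover have "underS {(p, p)} p = {}" by (auto simp: underS_def)
  ultimately have "free_sequence X {(p, p)} id"
    using p by (auto simp: free_sequence_def Field_def)
  from free_sequence_number_upper[OF this] have "|{p}| \<le>o free_sequence_number X"
    by (simp add: Field_def)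
  moreover have "Cnotzero |{p}|" 
    using card_of_Card_order[of "{p}"] by (simp add: card_of_ordIso_czero_iff_empty)
  ultimately show ?thesis
    using Cnotzero_mono Card_order_card_Sup unfolding free_sequence_number_def by blast
qed

theorem card_topspace_le_depth_cexp:
  fixes X :: "'a topology" and k :: "'k rel"
  assumes X: "Hausdorff_space X" and k: "Cinfinite k"
    and L: "covers_reduce_to X k" and F: "free_sequence_number X \<le>o k"
  shows "|topspace X| \<le>o depth X ^c k"
proof (cases "ctwo \<le>o depth X")
  \<comment> \<open>Two distinct points of a Hausdorff space form a discrete set, so depth below two
    leaves at most one point. This case is separate because a base of at least two is what makes the
    power exceed \<open>k\<close>.\<close>
  case False
  have single: "p = q" if pq: "p \<in> topspace X" "q \<in> topspace X" for p q
  proof (rule ccontr)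
    assume neq: "p \<noteq> q"
    obtain U V where UV: "openin X U" "openin X V" "p \<in> U" "q \<in> V" "disjnt U V"
      using X pq neq unfolding Hausdorff_space_def by metis
    have "discrete_subset X {p, q}"
    proof (rule discrete_subsetI)
      fix x assume "x \<in> {p, q}"
      then show "\<exists>W. openin X W \<and> W \<inter> {p, q} = {x}"
        using UV by (auto simp: disjnt_iff intro: exI[of _ U] exI[of _ V])
    qed (use pq in auto)
    moreover have "{p, q} \<subseteq> X closure_of {p, q}"
      using pq by (intro closure_of_subset) auto
    ultimately have "|{p, q}| \<le>o depth X"
      by (meson card_closure_of_discrete_le_depth card_of_subset_ordLeq)
    moreover have "ctwo \<le>o |{p, q}|"
      unfolding ctwo_def using neq
      by (intro card_of_ordLeqI[of "\<lambda>b. if b then p else q"]) (auto simp: inj_on_def)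
    ultimately show False using False ordLeq_transitive by blast
  qed
  have "|topspace X| \<le>o depth X"
  proof (cases "topspace X = {}")
    case False
    then obtain p where p: "p \<in> topspace X" by blast
    then have "topspace X \<subseteq> {p}" using single by blast
    also have "{p} \<subseteq> X closure_of {p}" using p by (intro closure_of_subset) auto
    finally have "|topspace X| \<le>o |X closure_of {p}|" by (rule card_of_mono1)
    then show ?thesis
      using card_closure_of_discrete_le_depth[OF discrete_subset_singleton[OF p]]
      by (rule ordLeq_transitive)
  qed (simp add: Card_order_empty Card_order_depth)
  then show ?thesis
    using ordLeq_cexp1[OF Cinfinite_Cnotzero[OF k] Card_order_depth] by (rule ordLeq_transitive)
next
  case two: True
  let ?g = "depth X" and ?l = "depth X ^c k"
  have l: "Cinfinite ?l" using Cinfinite_cexp two k by blast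
  have gl: "?g \<le>o ?l"
    by (rule ordLeq_cexp1[OF Cinfinite_Cnotzero[OF k] Card_order_depth])
  \<comment> \<open>The exponents multiply, and \<open>k *c k\<close> is \<open>k\<close> because
    \<open>k\<close> is infinite.\<close>
  have exp: "?l ^c k \<le>o ?l"
    using cexp_cprod_ordLeq[OF Card_order_depth k Cinfinite_Cnotzero[OF k]] k
      ordLeq_refl ordIso_imp_ordLeq by blast
  \<comment> \<open>Cantor's theorem, followed by monotonicity in the base.\<close>
  have "k <o ?l"
    using ordLess_ctwo_cexp[of k] cexp_mono1[OF two, of k] k ordLess_ordLeq_trans by blast
  then have kl: "cardSuc k \<le>o ?l" using cardSuc_least k l by blast
  then have k_le_l: "k \<le>o ?l" using k cardSuc_ordLeq ordLeq_transitive by blast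
  have "\<exists>N. |N| \<le>o ?g \<and> (p \<in> topspace X \<longrightarrow> (\<forall>U\<in>N. openin X U \<and> p \<in> U) \<and>
      (\<forall>q\<in>topspace X. q \<noteq> p \<longrightarrow> (\<exists>U\<in>N. q \<notin> U)))" for p
  proof (cases "p \<in> topspace X")
    case True
    then show ?thesis using Hausdorff_pseudobase_le_depth[OF X True] by metis
  next
    case False
    then show ?thesis
      using Card_order_empty[OF Card_order_depth] by (intro exI[of _ "{}"]) auto
  qed
  then obtain N where N: "\<And>p. |N p| \<le>o ?g"
    and Nopen: "\<And>p U. p \<in> topspace X \<Longrightarrow> U \<in> N p \<Longrightarrow> openin X U \<and> p \<in> U"
    and Nsep: "\<And>p q. p \<in> topspace X \<Longrightarrow> q \<in> topspace X \<Longrightarrow> q \<noteq> p \<Longrightarrow> \<exists>U\<in>N p. q \<notin> U"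
    by metis
  define c where "c \<V> = (SOME z. z \<in> topspace X - \<Union>\<V>)" for \<V>
  have c: "c \<V> \<in> topspace X - \<Union>\<V>" if "q \<in> topspace X" "q \<notin> \<Union>\<V>" for q \<V>
    unfolding c_def using that by (intro someI[of "\<lambda>z. z \<in> topspace X - \<Union>\<V>"]) blast
  \<comment> \<open>Intersecting with \<open>topspace X\<close> discards the arbitrary values of
    \<open>c\<close> at families that cover the space.\<close>
  define H where "H S = topspace X \<inter> ((if discrete_subset X S then X closure_of S else {}) \<union>
      c ` {\<V>. \<V> \<subseteq> \<Union>(N ` S) \<and> |\<V>| \<le>o k})" for S
  have H: "|H S| \<le>o ?l" if S: "|S| \<le>o k" for S
  proof -
    have "|if discrete_subset X S then X closure_of S else {}| \<le>o ?l"
      using card_closure_of_discrete_le_depth[of X S] gl ordLeq_transitive Card_order_empty l by auto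
    moreover have "|\<Union>(N ` S)| \<le>o ?l"
      using ordLeq_transitive[OF S k_le_l] ordLeq_transitive[OF N gl] l
      by (intro UNION_Cinfinite_bound) blast+
    then have "|{\<V>. \<V> \<subseteq> \<Union>(N ` S) \<and> |\<V>| \<le>o k}| \<le>o ?l"
      using card_of_bounded_subsets[OF l exp] k by blast
    then have "|c ` {\<V>. \<V> \<subseteq> \<Union>(N ` S) \<and> |\<V>| \<le>o k}| \<le>o ?l"
      by (rule card_of_image_ordLeq)
    ultimately have "|(if discrete_subset X S then X closure_of S else {}) \<union>
        c ` {\<V>. \<V> \<subseteq> \<Union>(N ` S) \<and> |\<V>| \<le>o k}| \<le>o ?l"
      using l by (intro Un_Cinfinite_bound)
    then show ?thesis
      unfolding H_def by (rule card_of_subset_ordLeq[OF Int_lower2])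
  qed
  obtain A where A: "|A| \<le>o ?l" "A \<subseteq> \<Union>(range H)"
      and closed: "\<And>S. S \<subseteq> A \<Longrightarrow> |S| \<le>o k \<Longrightarrow> H S \<subseteq> A"
    using closing_off[OF l exp k kl, of H] H by blast
  have AX: "A \<subseteq> topspace X" using A(2) by (auto simp: H_def)
  have "topspace X \<subseteq> A"
  proof (rule ccontr)
    assume "\<not> topspace X \<subseteq> A"
    then obtain q where q: "q \<in> topspace X" "q \<notin> A" by blast
    have "\<exists>U\<in>N p. q \<notin> U" if "p \<in> A" for p
      using Nsep[of p q] q AX that by blast
    then obtain u where u: "\<And>p. p \<in> A \<Longrightarrow> u p \<in> N p \<and> q \<notin> u p" by metis
    obtain x where "free_sequence X (cardSuc k) x"
    proof (rule free_sequence_cardSuc[OF k L AX, where u = u and c = c])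
      show "openin X (u p) \<and> p \<in> u p" if "p \<in> A" for p
        using u[OF that] Nopen AX that by blast
      show "X closure_of D \<subseteq> A" if "D \<subseteq> A" "|D| \<le>o k" "discrete_subset X D" for D
        using closed[OF that(1,2)] that(3) closure_of_subset_topspace[of X D] by (auto simp: H_def)
      fix \<V> assume \<V>: "\<V> \<subseteq> u ` A" "|\<V>| \<le>o k"
      \<comment> \<open>One index per member of \<open>\<V>\<close> keeps \<open>S\<close> as small
        as \<open>\<V>\<close>, so that closure under \<open>H\<close> applies to
        \<open>S\<close>.\<close>
      then obtain S where S: "S \<subseteq> A" "inj_on u S" "\<V> = u ` S"
        by (auto simp: subset_image_inj)
      have "|S| \<le>o k"
        using S(2,3) \<V>(2) card_of_ordLeqI[of u S \<V>] ordLeq_transitive by blast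
      \<comment> \<open>No \<open>u p\<close> contains \<open>q\<close>, so \<open>\<V>\<close>
        leaves a point uncovered and \<open>c \<V>\<close> is a genuine choice.\<close>
      moreover have cV: "c \<V> \<in> topspace X - \<Union>\<V>"
        using c[OF q(1)] \<V>(1) u by blast
      moreover have "\<V> \<subseteq> \<Union>(N ` S)" using S(1,3) u by blast
      ultimately show "c \<V> \<in> A - \<Union>\<V>"
        using closed[OF S(1)] \<V>(2) by (auto simp: H_def)
    qed
    from free_sequence_number_upper[OF this] have "|Field (cardSuc k)| \<le>o k"
      using F ordLeq_transitive by blast
    then have "cardSuc k \<le>o k"
      using k cardSuc_Card_order card_of_Field_ordIso ordIso_symmetric ordIso_ordLeq_trans by blast
    then show False using cardSuc_greater k not_ordLess_ordLeq by blast
  qed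
  then show ?thesis using A(1) by (rule card_of_subset_ordLeq)
qed

theorem theorem2:
  fixes X :: "'a topology"
  assumes "Hausdorff_space X"
  shows "|topspace X| \<le>o depth X ^c (Lindelof_degree X *c free_sequence_number X)"
proof (cases "topspace X = {}")
  \<comment> \<open>In the empty space all free sequences are empty, so the exponent would be zero
    and not infinite.\<close>
  case True
  then show ?thesis by (simp add: Card_order_empty Card_order_cexp)
next
  case False
  then obtain p where "p \<in> topspace X" by blast
  then have F: "Cnotzero (free_sequence_number X)"
    by (rule Cnotzero_free_sequence_number)
  have L: "Cinfinite (Lindelof_degree X)"
    using cinfinite_Lindelof_degree Card_order_Lindelof_degree by blast
  let ?k = "Lindelof_degree X *c free_sequence_number X"
  have "free_sequence_number X \<le>o ?k"
    using ordLeq_cprod2[OF Cinfinite_Cnotzero[OF L]] F by blast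
  \<comment> \<open>Here the existence of a point enters: multiplying by a nonzero cardinal does not
    decrease \<open>Lindelof_degree X\<close>.\<close>
  moreover have L_le: "Lindelof_degree X \<le>o ?k"
    using ordLeq_cprod2[OF F] L cprod_com ordLeq_ordIso_trans by blast
  then have "Cinfinite ?k" using cinfinite_mono L Card_order_cprod by blast
  moreover have "covers_reduce_to X ?k"
    using covers_reduce_to_mono[OF covers_reduce_to_Lindelof_degree L_le] .
  ultimately show ?thesis using card_topspace_le_depth_cexp[OF assms] by blast
qed

end
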